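(* Let $A$ be an $MV$-algebra. Define, for $x,y,z\in A$, $$m(x,y,z)=((x\ominus y)\oplus z)\wedge((z\ominus y)\oplus x).$$ Then $m$ is a Mal'tsev term; that is, $m(x,y,y)=m(y,y,x)=x$ for all $x,y\in A$. Consequently, the underlying space of every topological $MV$-algebra is a Mal'tsev space.
   Context: An $MV$-algebra is an algebra $(A,\oplus,{}^*,0)$ of type $(2,1,0)$ such that $(A,\oplus,0)$ is a commutative monoid, $x^{**}=x$, $x\oplus 0^*=0^*$ and $(x^*\oplus y)^*\oplus y=(y^*\oplus x)^*\oplus x$ for all $x,y$. One writes $1=0^*$, $x\odot y=(x^*\oplus y^* )^*$, $x\ominus y=x\odot y^*$, $x\le y$ iff $x^*\oplus y=1$, $x\vee y=y\oplus(x\ominus y)$, $x\wedge y=x\odot(x^*\oplus y)$. With this order $A$ is a bounded distributive lattice with join $\vee$ and meet $\wedge$. A topological $MV$-algebra is an $MV$-algebra $A$ equipped with a topology such that $\oplus:A\times A\to A$ and ${}^*:A\to A$ are continuous. All topological spaces (in particular all underlying spaces of topological $MV$-algebras) are assumed to be Tychonoff. A topological space $X$ is a Mal'tsev space if there exists a continuous map $m:X^3\to X$ with $m(x,y,y)=m(y,y,x)=x$ for all $x,y\in X$ (such a map is called a Mal'tsev operation). *)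

theory Defs
  imports "HOL-Analysis.Analysis" "HOL-Algebra.Congruence"
begin

record 'a mv_structure = "'a partial_object" +
  mv_plus :: "'a \<Rightarrow> 'a \<Rightarrow> 'a" (infixl "\<oplus>\<index>" 65)
  mv_neg :: "'a \<Rightarrow> 'a" ("\<sim>\<index> _" [81] 80)
  mv_zero :: "'a" ("\<zero>\<index>")

locale mv_algebra =
  fixes A (structure)
  assumes zero_closed: "\<zero> \<in> carrier A"
    and neg_closed: "x \<in> carrier A \<Longrightarrow> \<sim> x \<in> carrier A"
    and plus_closed: "\<lbrakk>x \<in> carrier A; y \<in> carrier A\<rbrakk> \<Longrightarrow> x \<oplus> y \<in> carrier A"
    and plus_assoc: "\<lbrakk>x \<in> carrier A; y \<in> carrier A; z \<in> carrier A\<rbrakk>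
      \<Longrightarrow> (x \<oplus> y) \<oplus> z = x \<oplus> (y \<oplus> z)"
    and plus_commute: "\<lbrakk>x \<in> carrier A; y \<in> carrier A\<rbrakk> \<Longrightarrow> x \<oplus> y = y \<oplus> x"
    and plus_zero: "x \<in> carrier A \<Longrightarrow> x \<oplus> \<zero> = x"
    and neg_neg: "x \<in> carrier A \<Longrightarrow> \<sim> (\<sim> x) = x"
    and plus_neg_zero: "x \<in> carrier A \<Longrightarrow> x \<oplus> \<sim> \<zero> = \<sim> \<zero>"
    and lukasiewicz: "\<lbrakk>x \<in> carrier A; y \<in> carrier A\<rbrakk>
      \<Longrightarrow> \<sim> (\<sim> x \<oplus> y) \<oplus> y = \<sim> (\<sim> y \<oplus> x) \<oplus> x"

definition mv_times :: "('a, 'b) mv_structure_scheme \<Rightarrow> 'a \<Rightarrow> 'a \<Rightarrow> 'a" (infixl "\<odot>\<index>" 70)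
  where "x \<odot>\<^bsub>A\<^esub> y = \<sim>\<^bsub>A\<^esub> (\<sim>\<^bsub>A\<^esub> x \<oplus>\<^bsub>A\<^esub> \<sim>\<^bsub>A\<^esub> y)"

definition mv_minus :: "('a, 'b) mv_structure_scheme \<Rightarrow> 'a \<Rightarrow> 'a \<Rightarrow> 'a" (infixl "\<ominus>\<index>" 65)
  where "x \<ominus>\<^bsub>A\<^esub> y = x \<odot>\<^bsub>A\<^esub> (\<sim>\<^bsub>A\<^esub> y)"

definition mv_meet :: "('a, 'b) mv_structure_scheme \<Rightarrow> 'a \<Rightarrow> 'a \<Rightarrow> 'a" (infixl "\<sqinter>\<index>" 60)
  where "x \<sqinter>\<^bsub>A\<^esub> y = x \<odot>\<^bsub>A\<^esub> (\<sim>\<^bsub>A\<^esub> x \<oplus>\<^bsub>A\<^esub> y)"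

definition mv_maltsev :: "('a, 'b) mv_structure_scheme \<Rightarrow> 'a \<Rightarrow> 'a \<Rightarrow> 'a \<Rightarrow> 'a"
  where "mv_maltsev A x y z =
    ((x \<ominus>\<^bsub>A\<^esub> y) \<oplus>\<^bsub>A\<^esub> z) \<sqinter>\<^bsub>A\<^esub> ((z \<ominus>\<^bsub>A\<^esub> y) \<oplus>\<^bsub>A\<^esub> x)"

definition maltsev_operation_on :: "'a set \<Rightarrow> ('a \<Rightarrow> 'a \<Rightarrow> 'a \<Rightarrow> 'a) \<Rightarrow> bool"
  where "maltsev_operation_on S m \<longleftrightarrow>
    (\<forall>x\<in>S. \<forall>y\<in>S. \<forall>z\<in>S. m x y z \<in> S) \<and>
    (\<forall>x\<in>S. \<forall>y\<in>S. m x y y = x \<and> m y y x = x)"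

definition tychonoff_space :: "'a topology \<Rightarrow> bool"
  where "tychonoff_space X \<longleftrightarrow> completely_regular_space X \<and> Hausdorff_space X"

text \<open>All spaces are assumed to be Tychonoff, so this is part of the two notions below.\<close>

definition maltsev_space :: "'a topology \<Rightarrow> bool"
  where "maltsev_space X \<longleftrightarrow> tychonoff_space X \<and>
    (\<exists>m. continuous_map (prod_topology X (prod_topology X X)) X (\<lambda>(x, y, z). m x y z) \<and>
         maltsev_operation_on (topspace X) m)"

locale topological_mv_algebra = mv_algebra A for A (structure) +
  fixes X
  assumes topspace_eq_carrier: "topspace X = carrier A"
    and tychonoff: "tychonoff_space X"
    and continuous_plus: "continuous_map (prod_topology X X) X (\<lambda>(x, y). x \<oplus> y)"
    and continuous_neg: "continuous_map X X (\<lambda>x. \<sim> x)"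

end

theory Submission
  imports Defs
begin

text \<open>
  Since \<open>y \<ominus> y = \<zero>\<close> and \<open>(x \<ominus> y) \<oplus> y\<close> is the join of \<open>x\<close> and \<open>y\<close>, both Mal'tsev identities
  reduce to absorption of \<open>x\<close> in its meet with that join.
\<close>

context mv_algebra
begin

lemma zero_plus: "x \<in> carrier A \<Longrightarrow> \<zero> \<oplus> x = x"
  by (metis plus_commute plus_zero zero_closed)

lemma neg_zero_plus: "x \<in> carrier A \<Longrightarrow> \<sim> \<zero> \<oplus> x = \<sim> \<zero>"
  by (metis plus_commute plus_neg_zero neg_closed zero_closed)

lemma times_closed: "\<lbrakk>x \<in> carrier A; y \<in> carrier A\<rbrakk> \<Longrightarrow> x \<odot> y \<in> carrier A"
  by (simp add: mv_times_def neg_closed plus_closed)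

lemma minus_closed: "\<lbrakk>x \<in> carrier A; y \<in> carrier A\<rbrakk> \<Longrightarrow> x \<ominus> y \<in> carrier A"
  by (simp add: mv_minus_def neg_closed times_closed)

lemma meet_closed: "\<lbrakk>x \<in> carrier A; y \<in> carrier A\<rbrakk> \<Longrightarrow> x \<sqinter> y \<in> carrier A"
  by (simp add: mv_meet_def neg_closed plus_closed times_closed)

lemma maltsev_closed:
  "\<lbrakk>x \<in> carrier A; y \<in> carrier A; z \<in> carrier A\<rbrakk> \<Longrightarrow> mv_maltsev A x y z \<in> carrier A"
  by (simp add: mv_maltsev_def meet_closed minus_closed plus_closed)

text \<open>The instance of \<open>lukasiewicz\<close> at the top element \<sim> \<zero> and x: its
  left side collapses to \<sim> x \<oplus> x because \<sim> \<sim> \<zero> = \<zero> is neutral, its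
  right side to \<sim> \<zero> because \<sim> \<zero> is absorbing.\<close>

lemma neg_plus_self:
  assumes "x \<in> carrier A"
  shows "\<sim> x \<oplus> x = \<sim> \<zero>"
  using lukasiewicz[of "\<sim> \<zero>" x] assms
  by (simp add: neg_closed neg_neg plus_neg_zero zero_closed zero_plus)

lemma minus_self: "x \<in> carrier A \<Longrightarrow> x \<ominus> x = \<zero>"
  by (simp add: mv_minus_def mv_times_def neg_neg neg_plus_self zero_closed)

text \<open>Brings the join into the shape of one side of \<open>lukasiewicz\<close>, which then
  says that the join is symmetric.\<close>

lemma minus_plus: "\<lbrakk>x \<in> carrier A; y \<in> carrier A\<rbrakk> \<Longrightarrow> (x \<ominus> y) \<oplus> y = \<sim> (\<sim> x \<oplus> y) \<oplus> y"
  by (simp add: mv_minus_def mv_times_def neg_neg)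

text \<open>In the order of the algebra this is x \<le> x \<or> y. By symmetry of the join, x itself
  occurs in it as a summand, and \<sim> x \<oplus> x is already the top element.\<close>

lemma minus_plus_upper:
  assumes "x \<in> carrier A" "y \<in> carrier A"
  shows "\<sim> x \<oplus> ((x \<ominus> y) \<oplus> y) = \<sim> \<zero>"
proof -
  let ?d = "\<sim> (\<sim> y \<oplus> x)"
  have d: "?d \<in> carrier A"
    using assms by (simp add: neg_closed plus_closed)
  have "\<sim> x \<oplus> ((x \<ominus> y) \<oplus> y) = \<sim> x \<oplus> (x \<oplus> ?d)"
    using assms d by (simp add: minus_plus lukasiewicz[of x y] plus_commute[of ?d x])
  also have "\<dots> = (\<sim> x \<oplus> x) \<oplus> ?d"
    using assms d by (simp add: plus_assoc neg_closed)
  also have "\<dots> = \<sim> \<zero>"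
    using assms d by (simp add: neg_plus_self neg_zero_plus)
  finally show ?thesis .
qed

text \<open>The second assumption is x \<le> y; under it the meet becomes x \<odot> \<sim> \<zero>,
  and \<sim> \<zero> is neutral for \<odot>.\<close>

lemma meet_absorb1:
  assumes "x \<in> carrier A" "\<sim> x \<oplus> y = \<sim> \<zero>"
  shows "x \<sqinter> y = x"
  using assms
  by (simp add: mv_meet_def mv_times_def neg_neg neg_closed plus_zero zero_closed)

lemma meet_commute:
  assumes "x \<in> carrier A" "y \<in> carrier A"
  shows "x \<sqinter> y = y \<sqinter> x"
proof -
  \<comment> \<open>De Morgan: the left side is the complement of x \<sqinter> y and the right side
    is the join of \<sim> y and \<sim> x, so symmetry of the join carries over to the meet.\<close>
  have "\<sim> x \<oplus> \<sim> (\<sim> x \<oplus> y) = \<sim> (\<sim> (\<sim> y) \<oplus> \<sim> x) \<oplus> \<sim> x"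
    using assms by (simp add: neg_neg neg_closed plus_closed plus_commute)
  also have "\<dots> = \<sim> (\<sim> (\<sim> x) \<oplus> \<sim> y) \<oplus> \<sim> y"
    using assms by (intro lukasiewicz neg_closed)
  also have "\<dots> = \<sim> y \<oplus> \<sim> (\<sim> y \<oplus> x)"
    using assms by (simp add: neg_neg neg_closed plus_closed plus_commute)
  finally show ?thesis
    by (simp add: mv_meet_def mv_times_def)
qed

lemma maltsev_left:
  assumes "x \<in> carrier A" "y \<in> carrier A"
  shows "mv_maltsev A y y x = x"
  using assms by (simp add: mv_maltsev_def minus_self zero_plus meet_absorb1 minus_plus_upper)

lemma maltsev_right:
  assumes "x \<in> carrier A" "y \<in> carrier A"
  shows "mv_maltsev A x y y = x"
proof -
  \<comment> \<open>Exchanging the outer arguments of the term only swaps the two operands of the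
    meet.\<close>
  have "mv_maltsev A x y y = mv_maltsev A y y x"
    using assms
    by (simp add: mv_maltsev_def meet_commute minus_closed plus_closed)
  then show ?thesis
    using assms by (simp add: maltsev_left)
qed

lemma maltsev_operation_on_carrier: "maltsev_operation_on (carrier A) (mv_maltsev A)"
  by (simp add: maltsev_operation_on_def maltsev_closed maltsev_left maltsev_right)

end

context topological_mv_algebra
begin

lemma continuous_map_neg:
  assumes "continuous_map Y X f"
  shows "continuous_map Y X (\<lambda>t. \<sim> f t)"
  using continuous_map_compose[OF assms continuous_neg] by (simp add: o_def)

lemma continuous_map_plus:
  assumes "continuous_map Y X f" "continuous_map Y X g"
  shows "continuous_map Y X (\<lambda>t. f t \<oplus> g t)"
proof -
  have "continuous_map Y (prod_topology X X) (\<lambda>t. (f t, g t))"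
    using assms by (rule continuous_map_pairedI)
  from continuous_map_compose[OF this continuous_plus] show ?thesis
    by (simp add: o_def)
qed

text \<open>Once unfolded, the term is built from \<oplus> and \<sim> alone. The source space
  \<open>Y\<close> is arbitrary so that the two preceding rules apply to every nested
  subterm.\<close>

lemma continuous_map_maltsev:
  assumes "continuous_map Y X f" "continuous_map Y X g" "continuous_map Y X h"
  shows "continuous_map Y X (\<lambda>t. mv_maltsev A (f t) (g t) (h t))"
  unfolding mv_maltsev_def mv_meet_def mv_minus_def mv_times_def
  by (intro continuous_map_plus continuous_map_neg assms)

lemma maltsev_space: "maltsev_space X"
proof -
  let ?P = "prod_topology X (prod_topology X X)"
  \<comment> \<open>Projections replace the tuple pattern, so that each argument is a continuous
    function of the single point \<open>t\<close>.\<close>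
  have "continuous_map ?P X (\<lambda>t. mv_maltsev A (fst t) (fst (snd t)) (snd (snd t)))"
    by (intro continuous_map_maltsev continuous_map_fst
        continuous_map_compose[OF continuous_map_snd, unfolded o_def] continuous_map_snd)
  then have "continuous_map ?P X (\<lambda>(x, y, z). mv_maltsev A x y z)"
    by (simp add: case_prod_unfold)
  then show ?thesis
    using tychonoff maltsev_operation_on_carrier
    by (auto simp: maltsev_space_def topspace_eq_carrier)
qed

end

theorem proposition3p1:
  fixes A :: "('a, 'b) mv_structure_scheme"
  assumes "mv_algebra A"
  shows "maltsev_operation_on (carrier A) (mv_maltsev A) \<and>
    (\<forall>X. topological_mv_algebra A X \<longrightarrow> maltsev_space X)"
  using mv_algebra.maltsev_operation_on_carrier[OF assms]
    topological_mv_algebra.maltsev_space by blast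

end
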